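(* The mapping $\phi$ establishes a one-to-one correspondence between $\mathrm{SOL}(\mathcal{C}\cap\mathcal{N}_n,\mathcal{F})$ and $\mathrm{SOL}(\phi(\mathcal{C}\cap\mathcal{N}_n),\hat F)$. In other words, if $x(\cdot)$ is a solution of $$-\mathcal{F}(x(\cdot))\in N_{\mathcal{C}\cap\mathcal{N}_n}(x(\cdot)),$$ then $\phi(x(\cdot))$ is a solution $x$ of $$-\hat F(x)\in N_{\phi(\mathcal{C}\cap\mathcal{N}_n)}(x),$$ and vice versa.
   Context: Let $N\ge1$ and $n_1,\dots,n_N\ge 1$ be integers, $n=\sum_{k=1}^N n_k$. Let $\Xi=\Xi_1\times\cdots\times\Xi_N=\{\xi^1,\dots,\xi^J\}$ be a finite sample space whose elements $\xi=(\xi_1,\dots,\xi_N)$ have probabilities $p(\xi)>0$ summing to $1$. $\mathcal{L}_n$ is the Hilbert space of all maps $x(\cdot):\Xi\to\mathbb{R}^n$, $x(\xi)=(x_1(\xi),\dots,x_N(\xi))$ with $x_k(\xi)\in\mathbb{R}^{n_k}$, with inner product $\langle x(\cdot),w(\cdot)\rangle=\sum_{\xi\in\Xi}p(\xi)\sum_{k=1}^N\langle x_k(\xi),w_k(\xi)\rangle$. Let $\mathcal{N}_n=\{x(\cdot)\in\mathcal{L}_n: x_k(\xi)\text{ does not depend on }\xi_k,\dots,\xi_N,\ k=1,\dots,N\}$. For each $\xi$ let $C(\xi)\subset\mathbb{R}^n$ be nonempty closed convex, and $\mathcal{C}=\{x(\cdot)\in\mathcal{L}_n:x(\xi)\in C(\xi)\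 \forall\xi\in\Xi\}$. $\mathcal{F}:\mathcal{L}_n\to\mathcal{L}_n$ is given by $\mathcal{F}(x(\cdot)):\xi\mapsto F(x(\xi),\xi)$, with $F(\cdot,\xi):\mathbb{R}^n\to\mathbb{R}^n$ for each $\xi$. Let $\bar n=nJ$ and $\phi:\mathcal{L}_n\to\mathbb{R}^{\bar n}$, $\phi(x(\cdot))=(x_{p_1}^T,\dots,x_{p_J}^T)^T$ with $x_{p_i}=\sqrt{p(\xi^i)}\,x(\xi^i)$. Define $\hat F:\mathbb{R}^{\bar n}\to\mathbb{R}^{\bar n}$ by $\hat F(x)=\big(\sqrt{p(\xi^i)}\,F(x_{p_i}/\sqrt{p(\xi^i)},\xi^i)\big)_{i=1}^J$ for $x=(x_{p_1}^T,\dots,x_{p_J}^T)^T$. For a convex set $S$ in a Hilbert space and $x\in S$, $N_S(x)=\{v:\langle v,y-x\rangle\le0\ \forall y\in S\}$ is the normal cone (solutions are understood to lie in $S$). $\mathrm{SOL}(\mathcal{C}\cap\mathcal{N}_n,\mathcal{F})$ and $\mathrm{SOL}(\phi(\mathcal{C}\cap\mathcal{N}_n),\hat F)$ are the solution sets of the first and the second displayed inclusions, respectively. *)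

theory Defs
  imports "HOL-Analysis.Analysis"
begin

text \<open>
  The sample space is a set \<open>X\<close> of tuples \<open>\<xi> = (\<xi>\<^sub>1, \<dots>, \<xi>\<^sub>N)\<close>, rendered as functions on \<open>nat\<close>.
  The enumeration \<open>\<xi>\<^sup>1, \<dots>, \<xi>\<^sup>J\<close> is a bijection \<open>xi\<close> from a finite index type \<open>'j\<close> onto \<open>X\<close>.

  The coordinates of \<open>\<real>\<^sup>n\<close> are indexed by a finite type \<open>'n\<close>, together with a bijection
  \<open>co\<close> from the pairs \<open>(k, l)\<close> with \<open>1 \<le> k \<le> N\<close>, \<open>1 \<le> l \<le> n\<^sub>k\<close> onto \<open>'n\<close>: \<open>co k l\<close> is the
  \<open>l\<close>-th coordinate of the \<open>k\<close>-th block. Hence \<open>n = n\<^sub>1 + \<dots> + n\<^sub>N\<close> is the cardinality of \<open>'n\<close>,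
  and the space of dimension \<open>n J\<close> is \<open>real ^ ('j \<times> 'n)\<close>.
\<close>

definition block :: "(nat \<Rightarrow> nat) \<Rightarrow> (nat \<Rightarrow> nat \<Rightarrow> 'n::finite) \<Rightarrow> nat \<Rightarrow> real ^ 'n \<Rightarrow> nat \<Rightarrow> real" where
  "block nn co k v = (\<lambda>l\<in>{1..nn k}. v $ co k l)"

text \<open>
  Maps on \<open>X\<close> are represented by functions that vanish outside \<open>X\<close>; this makes the representation
  unique and closed under the pointwise operations.
\<close>

definition Lspace :: "'x set \<Rightarrow> ('x \<Rightarrow> real ^ 'n::finite) set" where
  "Lspace X = {x. \<forall>\<xi>. \<xi> \<notin> X \<longrightarrow> x \<xi> = 0}"

definition Linner ::
  "nat \<Rightarrow> (nat \<Rightarrow> nat) \<Rightarrow> (nat \<Rightarrow> nat \<Rightarrow> 'n::finite) \<Rightarrow> 'x set \<Rightarrow> ('x \<Rightarrow> real)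
     \<Rightarrow> ('x \<Rightarrow> real ^ 'n) \<Rightarrow> ('x \<Rightarrow> real ^ 'n) \<Rightarrow> real" where
  "Linner N nn co X p x w =
     (\<Sum>\<xi>\<in>X. p \<xi> * (\<Sum>k=1..N. \<Sum>l=1..nn k. block nn co k (x \<xi>) l * block nn co k (w \<xi>) l))"

definition nonanticipative ::
  "nat \<Rightarrow> (nat \<Rightarrow> nat) \<Rightarrow> (nat \<Rightarrow> nat \<Rightarrow> 'n::finite) \<Rightarrow> (nat \<Rightarrow> 's) set
     \<Rightarrow> ((nat \<Rightarrow> 's) \<Rightarrow> real ^ 'n) set" where
  "nonanticipative N nn co X =
     {x \<in> Lspace X. \<forall>k\<in>{1..N}. \<forall>\<xi>\<in>X. \<forall>\<eta>\<in>X.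
        (\<forall>l\<in>{1..<k}. \<xi> l = \<eta> l) \<longrightarrow> block nn co k (x \<xi>) = block nn co k (x \<eta>)}"

definition constraint_set :: "'x set \<Rightarrow> ('x \<Rightarrow> (real ^ 'n::finite) set) \<Rightarrow> ('x \<Rightarrow> real ^ 'n) set" where
  "constraint_set X C = {x \<in> Lspace X. \<forall>\<xi>\<in>X. x \<xi> \<in> C \<xi>}"

definition F_map ::
  "'x set \<Rightarrow> (real ^ 'n::finite \<Rightarrow> 'x \<Rightarrow> real ^ 'n) \<Rightarrow> ('x \<Rightarrow> real ^ 'n) \<Rightarrow> 'x \<Rightarrow> real ^ 'n" where
  "F_map X F x = (\<lambda>\<xi>. if \<xi> \<in> X then F (x \<xi>) \<xi> else 0)"

text \<open>
  Normal cones and solution sets in a space with carrier \<open>H\<close> and inner product \<open>ip\<close>. The inner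
  product is a parameter because that of \<^const>\<open>Lspace\<close> depends on the probabilities.
\<close>

definition normal_cone :: "'a::minus set \<Rightarrow> ('a \<Rightarrow> 'a \<Rightarrow> real) \<Rightarrow> 'a set \<Rightarrow> 'a \<Rightarrow> 'a set" where
  "normal_cone H ip S x = {v \<in> H. \<forall>y\<in>S. ip v (y - x) \<le> 0}"

definition SOL ::
  "'a::{minus,uminus} set \<Rightarrow> ('a \<Rightarrow> 'a \<Rightarrow> real) \<Rightarrow> 'a set \<Rightarrow> ('a \<Rightarrow> 'a) \<Rightarrow> 'a set" where
  "SOL H ip S G = {x \<in> S. - G x \<in> normal_cone H ip S x}"

definition stack :: "('j::finite \<Rightarrow> real ^ 'n::finite) \<Rightarrow> real ^ ('j \<times> 'n)" where
  "stack b = (\<chi> ic. b (fst ic) $ snd ic)"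

definition piece :: "real ^ ('j::finite \<times> 'n::finite) \<Rightarrow> 'j \<Rightarrow> real ^ 'n" where
  "piece x i = (\<chi> c. x $ (i, c))"

definition phi ::
  "('x \<Rightarrow> real) \<Rightarrow> ('j::finite \<Rightarrow> 'x) \<Rightarrow> ('x \<Rightarrow> real ^ 'n::finite) \<Rightarrow> real ^ ('j \<times> 'n)" where
  "phi p xi x = stack (\<lambda>i. sqrt (p (xi i)) *\<^sub>R x (xi i))"

definition F_hat ::
  "('x \<Rightarrow> real) \<Rightarrow> ('j::finite \<Rightarrow> 'x) \<Rightarrow> (real ^ 'n::finite \<Rightarrow> 'x \<Rightarrow> real ^ 'n)
     \<Rightarrow> real ^ ('j \<times> 'n) \<Rightarrow> real ^ ('j \<times> 'n)" where
  "F_hat p xi F x =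
     stack (\<lambda>i. sqrt (p (xi i)) *\<^sub>R F (piece x i /\<^sub>R sqrt (p (xi i))) (xi i))"

end

theory Submission
  imports Defs
begin

text \<open>
  A variational inequality is stated entirely in terms of inner products of a value of the operator
  with a difference of feasible points. It is therefore carried over by every injective map \<open>f\<close>
  that is linear, preserves the inner product, and intertwines the two operators: the inequality to
  be checked for \<open>f x\<close> against \<open>f y\<close> is literally the same real inequality as the one for \<open>x\<close>
  against \<open>y\<close>, and injectivity identifies the solutions (\<open>SOL_image_isometry\<close>).

  The map \<^const>\<open>phi\<close> is of this kind. The factor \<open>\<surd>p\<close> occurs once in each argument of the Euclidean
  inner product and thus produces exactly the weight \<open>p\<close> of the inner product on
  \<^const>\<open>Lspace\<close> (\<open>inner_phi\<close>, \<open>Linner_eq_inner\<close>); since the weights are positive, nothing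
  is lost and \<^const>\<open>phi\<close> is injective (\<open>inj_on_phi\<close>); and \<^const>\<open>F_hat\<close> first divides the pieces by
  \<open>\<surd>p\<close>, which recovers the original map, and then stacks the values of \<open>F\<close> with weight \<open>\<surd>p\<close>, so it
  is the conjugate of \<^const>\<open>F_map\<close> under \<^const>\<open>phi\<close> (\<open>F_hat_phi\<close>).
\<close>

text \<open>
  Only differences of feasible points are tested against \<open>- G x\<close>, so the operator and the inner
  products need to be compared at feasible points alone.
\<close>

lemma mem_SOL_isometry_iff:
  assumes inj: "inj_on f H" and "S \<subseteq> H" and "x \<in> H"
    and carrier: "- G x \<in> H" "- G' (f x) \<in> H'"
    and isometry: "\<And>y. y \<in> S \<Longrightarrow> x \<in> S \<Longrightarrow> ip' (- G' (f x)) (f y - f x) = ip (- G x) (y - x)"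
  shows "f x \<in> SOL H' ip' (f ` S) G' \<longleftrightarrow> x \<in> SOL H ip S G"
proof -
  have "f x \<in> f ` S \<longleftrightarrow> x \<in> S"
    using inj_on_image_mem_iff[OF inj \<open>x \<in> H\<close> \<open>S \<subseteq> H\<close>] .
  then show ?thesis
    using carrier isometry by (auto simp: SOL_def normal_cone_def)
qed

lemma SOL_image_isometry:
  assumes "inj_on f H" and "S \<subseteq> H"
    and "\<And>x. x \<in> S \<Longrightarrow> - G x \<in> H" and "\<And>x. x \<in> S \<Longrightarrow> - G' (f x) \<in> H'"
    and "\<And>x y. x \<in> S \<Longrightarrow> y \<in> S \<Longrightarrow> ip' (- G' (f x)) (f y - f x) = ip (- G x) (y - x)"
  shows "bij_betw f (SOL H ip S G) (SOL H' ip' (f ` S) G')"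
proof -
  have iff: "f x \<in> SOL H' ip' (f ` S) G' \<longleftrightarrow> x \<in> SOL H ip S G" if "x \<in> S" for x
    using assms that by (intro mem_SOL_isometry_iff) auto
  have "SOL H ip S G \<subseteq> S" "SOL H' ip' (f ` S) G' \<subseteq> f ` S"
    by (auto simp: SOL_def)
  with iff have "f ` SOL H ip S G = SOL H' ip' (f ` S) G'"
    by blast
  moreover have "inj_on f (SOL H ip S G)"
    using assms(1,2) \<open>SOL H ip S G \<subseteq> S\<close> by (meson inj_on_subset order_trans)
  ultimately show ?thesis
    by (simp add: bij_betw_def)
qed

text \<open>
  Since \<open>co\<close> enumerates every coordinate exactly once, summing over blocks and then within each
  block is a single sum over all coordinates.
\<close>

lemma Linner_eq_inner:
  assumes "bij_betw (\<lambda>(k, l). co k l) (SIGMA k:{1..N}. {1..nn k}) UNIV"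
  shows "Linner N nn co X p x w = (\<Sum>\<xi>\<in>X. p \<xi> * (x \<xi> \<bullet> w \<xi>))"
proof -
  have "(\<Sum>k=1..N. \<Sum>l=1..nn k. block nn co k v l * block nn co k u l) = v \<bullet> u" for u v
  proof -
    have "(\<Sum>k=1..N. \<Sum>l=1..nn k. block nn co k v l * block nn co k u l)
        = (\<Sum>k=1..N. \<Sum>l=1..nn k. v $ co k l * u $ co k l)"
      by (intro sum.cong) (auto simp: block_def)
    also have "\<dots> = (\<Sum>(k, l)\<in>(SIGMA k:{1..N}. {1..nn k}). v $ co k l * u $ co k l)"
      by (rule sum.Sigma) auto
    also have "\<dots> = (\<Sum>c\<in>UNIV. v $ c * u $ c)"
      using sum.reindex_bij_betw[OF assms, of "\<lambda>c. v $ c * u $ c"]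
      by (simp add: case_prod_unfold)
    finally show ?thesis
      by (simp add: inner_vec_def)
  qed
  then show ?thesis
    by (simp add: Linner_def)
qed

lemma inner_stack: "stack a \<bullet> stack b = (\<Sum>i\<in>UNIV. a i \<bullet> b i)"
  by (simp add: inner_vec_def stack_def sum.cartesian_product case_prod_unfold)

lemma piece_stack [simp]: "piece (stack b) = b"
  by (simp add: piece_def stack_def fun_eq_iff vec_eq_iff)

lemma phi_minus: "phi p xi (- x) = - phi p xi x"
  by (simp add: phi_def stack_def vec_eq_iff)

lemma phi_diff: "phi p xi (x - y) = phi p xi x - phi p xi y"
  by (simp add: phi_def stack_def vec_eq_iff algebra_simps)

lemma inner_phi:
  assumes "bij_betw xi UNIV X" and "\<And>\<xi>. \<xi> \<in> X \<Longrightarrow> p \<xi> \<ge> 0"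
  shows "phi p xi x \<bullet> phi p xi w = (\<Sum>\<xi>\<in>X. p \<xi> * (x \<xi> \<bullet> w \<xi>))"
proof -
  have "p (xi i) \<ge> 0" for i
    using assms by (auto simp: bij_betw_def)
  then have "phi p xi x \<bullet> phi p xi w = (\<Sum>i\<in>UNIV. p (xi i) * (x (xi i) \<bullet> w (xi i)))"
    by (simp add: phi_def inner_stack flip: mult.assoc)
  also have "\<dots> = (\<Sum>\<xi>\<in>X. p \<xi> * (x \<xi> \<bullet> w \<xi>))"
    by (rule sum.reindex_bij_betw[OF assms(1)])
  finally show ?thesis .
qed

lemma piece_phi:
  assumes "p (xi i) > 0"
  shows "piece (phi p xi x) i /\<^sub>R sqrt (p (xi i)) = x (xi i)"
  using assms by (simp add: phi_def)

text \<open>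
  The values at scenarios of positive probability can be read off from the pieces; outside \<open>X\<close> the
  elements of \<^const>\<open>Lspace\<close> vanish by convention.
\<close>

lemma inj_on_phi:
  assumes "xi ` UNIV = X" and "\<And>\<xi>. \<xi> \<in> X \<Longrightarrow> p \<xi> > 0"
  shows "inj_on (phi p xi) (Lspace X)"
proof (rule inj_onI)
  fix x y
  assume xy: "x \<in> Lspace X" "y \<in> Lspace X" and eq: "phi p xi x = phi p xi y"
  have "x (xi i) = y (xi i)" for i
    using piece_phi[of p xi i] assms eq by (metis rangeI)
  then have "x \<xi> = y \<xi>" for \<xi>
    using assms(1) xy by (cases "\<xi> \<in> X") (auto simp: Lspace_def)
  then show "x = y"
    by auto
qed

lemma F_hat_phi:
  assumes "xi ` UNIV = X" and "\<And>\<xi>. \<xi> \<in> X \<Longrightarrow> p \<xi> > 0"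
  shows "F_hat p xi F (phi p xi x) = phi p xi (F_map X F x)"
proof -
  have "xi i \<in> X" for i
    using assms(1) by auto
  with assms(2) show ?thesis
    by (simp only: F_hat_def piece_phi) (simp add: phi_def F_map_def)
qed

lemma uminus_F_map_in_Lspace: "- F_map X F x \<in> Lspace X"
  by (simp add: Lspace_def F_map_def)

theorem lemma6:
  fixes N :: nat
    and nn :: "nat \<Rightarrow> nat"
    and co :: "nat \<Rightarrow> nat \<Rightarrow> 'n::finite"
    and Xi :: "nat \<Rightarrow> 's set"
    and X :: "(nat \<Rightarrow> 's) set"
    and xi :: "'j::finite \<Rightarrow> nat \<Rightarrow> 's"
    and p :: "(nat \<Rightarrow> 's) \<Rightarrow> real"
    and C :: "(nat \<Rightarrow> 's) \<Rightarrow> (real ^ 'n) set"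
    and F :: "real ^ 'n \<Rightarrow> (nat \<Rightarrow> 's) \<Rightarrow> real ^ 'n"
  assumes "N \<ge> 1"
    and "\<And>k. k \<in> {1..N} \<Longrightarrow> nn k \<ge> 1"
    and "bij_betw (\<lambda>(k, l). co k l) (SIGMA k:{1..N}. {1..nn k}) (UNIV :: 'n set)"
    and "X = (\<Pi>\<^sub>E k\<in>{1..N}. Xi k)"
    and "finite X"
    and "bij_betw xi (UNIV :: 'j set) X"
    and "\<And>\<xi>. \<xi> \<in> X \<Longrightarrow> p \<xi> > 0"
    and "(\<Sum>\<xi>\<in>X. p \<xi>) = 1"
    and "\<And>\<xi>. \<xi> \<in> X \<Longrightarrow> C \<xi> \<noteq> {} \<and> closed (C \<xi>) \<and> convex (C \<xi>)"
  defines "S \<equiv> constraint_set X C \<inter> nonanticipative N nn co X"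
  defines "Sol \<equiv> SOL (Lspace X) (Linner N nn co X p) S (F_map X F)"
  defines "Sol_hat \<equiv> SOL UNIV inner (phi p xi ` S) (F_hat p xi F)"
  shows "bij_betw (phi p xi) Sol Sol_hat
    \<and> (\<forall>x\<in>Lspace X. x \<in> Sol \<longleftrightarrow> phi p xi x \<in> Sol_hat)"
proof -
  let ?f = "phi p xi"
  have range: "xi ` UNIV = X"
    using assms(6) by (simp add: bij_betw_def)
  have inj: "inj_on ?f (Lspace X)"
    using range assms(7) by (rule inj_on_phi)
  have S: "S \<subseteq> Lspace X"
    by (auto simp: S_def constraint_set_def)
  have isometry: "?f x \<bullet> ?f w = Linner N nn co X p x w" for x w
    using inner_phi[OF assms(6), of p] assms(7)
    by (simp add: Linner_eq_inner[OF assms(3)] less_imp_le)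
  have conj: "F_hat p xi F (?f x) = ?f (F_map X F x)" for x
    using range assms(7) by (rule F_hat_phi)
  have "- F_hat p xi F (?f x) \<bullet> (?f y - ?f x) = Linner N nn co X p (- F_map X F x) (y - x)" for x y
    by (simp only: conj isometry flip: phi_minus phi_diff)
  note * = inj S uminus_F_map_in_Lspace UNIV_I this
  have "bij_betw ?f Sol Sol_hat"
    unfolding Sol_def Sol_hat_def by (rule SOL_image_isometry) (rule *)+
  moreover have "x \<in> Sol \<longleftrightarrow> ?f x \<in> Sol_hat" if "x \<in> Lspace X" for x
    unfolding Sol_def Sol_hat_def
    by (rule mem_SOL_isometry_iff[symmetric]) (rule * that)+
  ultimately show ?thesis
    by blast
qed

end
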